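(* Let $R$ be an integral domain of characteristic $2$ and $D=f(x_1)\partial_1$ a nonzero derivation of $R[x_1]$, where $f(x_1)\in R[x_1]$. Then $D$ is locally nilpotent if and only if $f(x_1)=f_0(x_1^2)$ for some $f_0(x_1^2)\in R[x_1^2]$.
   Context: $\partial_1=\frac{\partial}{\partial x_1}$. An $R$-linear endomorphism $\eta$ of $R[x_1]$ is locally nilpotent if for each $a\in R[x_1]$ there exists $m\geq1$ with $\eta^m(a)=0$. *)

theory Defs
  imports "HOL-Computational_Algebra.Polynomial"
begin

text \<open>
  The polynomial ring over R in the single variable \<open>x\<^sub>1\<close> is \<^typ>\<open>'a poly\<close>, with R the
  type \<^typ>\<open>'a\<close>; its R-module structure is \<^const>\<open>smult\<close>.
\<close>

definition R_derivation :: "('a::comm_ring_1 poly \<Rightarrow> 'a poly) \<Rightarrow> bool" where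
  "R_derivation D \<longleftrightarrow>
     module_hom smult smult D \<and> (\<forall>p q. D (p * q) = p * D q + D p * q)"

definition locally_nilpotent :: "('a::comm_ring_1 poly \<Rightarrow> 'a poly) \<Rightarrow> bool" where
  "locally_nilpotent \<eta> \<longleftrightarrow>
     module_hom smult smult \<eta> \<and> (\<forall>a. \<exists>m\<ge>1. (\<eta> ^^ m) a = 0)"

definition f_partial :: "'a::idom poly \<Rightarrow> 'a poly \<Rightarrow> 'a poly" where
  "f_partial f = (\<lambda>p. f * pderiv p)"

lemma R_derivation_f_partial: "R_derivation (f_partial f)"
  unfolding R_derivation_def f_partial_def
  by (auto intro!: module_hom.intro module.intro module_hom_axioms.intro
      simp: smult_add_right smult_add_left pderiv_add pderiv_smult pderiv_mult algebra_simps)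

end

theory Submission
  imports Defs
begin

text \<open>
  Write \<open>f'\<close> for the formal derivative.  In characteristic 2 the second derivative of every
  polynomial vanishes, because the product of two consecutive integers is even.  Hence \<open>D = f\<partial>\<close>
  satisfies \<open>D\<^sup>2 p = f (f' p' + f p'') = f' D p\<close>, and since \<open>D f' = f f'' = 0\<close> the factor \<open>f'\<close>
  behaves as a constant under further applications of \<open>D\<close>: the iterates are
  \<open>D\<^sup>m\<^sup>+\<^sup>1 p = (f')\<^sup>m D p\<close> (lemma \<open>f_partial_funpow_char_2\<close>).
  Taking \<open>p = x\<close>, where \<open>D x = f \<noteq> 0\<close>, shows that over a domain local nilpotency forces \<open>f' = 0\<close>;
  conversely \<open>f' = 0\<close> gives \<open>D\<^sup>2 = 0\<close>.  It remains to recognise the polynomials with zero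
  derivative as those in \<open>x\<^sup>2\<close>; lemma \<open>pderiv_eq_0_iff_pcompose_CHAR\<close> does this in any prime
  characteristic.
\<close>

lemma pcompose_monom_monom:
  fixes c :: "'a::idom"
  shows "pcompose (monom c i) (monom 1 n) = monom c (n * i)"
  by (simp add: pcompose_altdef map_poly_monom poly_monom monom_power smult_monom)

text \<open>
  The coefficient of \<open>x\<^sup>n\<^sup>-\<^sup>1\<close> in \<open>f'\<close> is \<open>n\<close> times that of \<open>x\<^sup>n\<close> in \<open>f\<close>, and in a domain this
  product vanishes only if the characteristic divides \<open>n\<close> or the coefficient of \<open>f\<close> is zero.
  So \<open>f' = 0\<close> leaves only exponents divisible by the characteristic; collecting the surviving
  coefficients gives \<open>g\<close>.
\<close>

lemma pderiv_eq_0_iff_pcompose_CHAR: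
  fixes f :: "'a::idom poly"
  assumes char_pos: "CHAR('a) > 0"
  shows "pderiv f = 0 \<longleftrightarrow> (\<exists>g. f = pcompose g (monom 1 CHAR('a)))"
proof
  let ?p = "CHAR('a)"
  assume deriv: "pderiv f = 0"
  define g where "g = (\<Sum>i\<le>degree f. monom (coeff f (?p * i)) i)"
  have coeff_0: "coeff f n = 0" if "\<not> ?p dvd n" for n
  proof (cases n)
    case (Suc k)
    have "of_nat n * coeff f n = 0"
      using arg_cong[OF deriv, of "\<lambda>q. coeff q k"] by (simp add: coeff_pderiv Suc)
    then show ?thesis
      using that by (simp add: of_nat_eq_0_iff_char_dvd del: of_nat_Suc)
  qed (use that in simp)
  have "pcompose g (monom 1 ?p) = (\<Sum>i\<le>degree f. monom (coeff f (?p * i)) (?p * i))"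
    by (simp add: g_def pcompose_sum pcompose_monom_monom)
  moreover have "f = (\<Sum>i\<le>degree f. monom (coeff f (?p * i)) (?p * i))"
  proof (rule poly_eqI)
    fix n
    show "coeff f n = coeff (\<Sum>i\<le>degree f. monom (coeff f (?p * i)) (?p * i)) n"
    proof (cases "?p dvd n")
      case True
      then obtain k where n: "n = ?p * k" by blast
      \<comment> \<open>The sum stops at \<open>degree f\<close>, which loses nothing: a larger \<open>k\<close> makes \<open>n\<close> exceed the degree.\<close>
      have "k \<le> n" using n char_pos by simp
      then have "coeff f n = 0" if "\<not> k \<le> degree f"
        using that by (intro coeff_eq_0) simp
      then show ?thesis
        using char_pos by (auto simp: n coeff_sum)
    next
      case False
      then show ?thesis
        unfolding coeff_sum coeff_0[OF False] by (intro sum.neutral[symmetric]) auto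
    qed
  qed
  ultimately show "\<exists>g. f = pcompose g (monom 1 ?p)"
    by metis
next
  assume "\<exists>g. f = pcompose g (monom 1 CHAR('a))"
  then show "pderiv f = 0"
    by (auto simp: pderiv_pcompose pderiv_monom)
qed

lemma pderiv_pderiv_eq_0_char_2:
  fixes p :: "'a::idom poly"
  assumes "CHAR('a) = 2"
  shows "pderiv (pderiv p) = 0"
proof (rule poly_eqI)
  fix n
  have "(of_nat (Suc n * Suc (Suc n)) :: 'a) = 0"
    unfolding of_nat_eq_0_iff_char_dvd assms by simp
  then show "coeff (pderiv (pderiv p)) n = coeff 0 n"
    by (simp only: coeff_pderiv of_nat_mult mult.assoc[symmetric]) simp
qed

text \<open>
  Differentiating the factor \<open>f\<close> of \<open>f p'\<close> is the only part of the product rule that survives, so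
  each application beyond the first contributes one more factor \<open>f'\<close>.
\<close>

lemma f_partial_funpow_char_2:
  fixes f :: "'a::idom poly"
  assumes "CHAR('a) = 2"
  shows "(f_partial f ^^ Suc m) p = pderiv f ^ m * f_partial f p"
proof (induction m)
  case (Suc m)
  have "pderiv (pderiv f ^ m) = 0"
    by (simp add: pderiv_power pderiv_pderiv_eq_0_char_2[OF assms])
  then have step: "f_partial f (pderiv f ^ m * f_partial f p) = pderiv f ^ Suc m * f_partial f p"
    by (simp add: f_partial_def pderiv_mult pderiv_pderiv_eq_0_char_2[OF assms] algebra_simps)
  show ?case
    by (subst funpow.simps) (simp only: o_apply Suc step)
qed simp

theorem theorem3p4:
  fixes f :: "'a::idom poly" and D :: "'a poly \<Rightarrow> 'a poly"
  assumes "CHAR('a) = 2"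
    and "R_derivation D"
    and "D = f_partial f"
    and "D \<noteq> (\<lambda>p. 0)"
  shows "locally_nilpotent D \<longleftrightarrow> (\<exists>f\<^sub>0 :: 'a poly. f = pcompose f\<^sub>0 (monom 1 2))"
proof -
  note iterates = f_partial_funpow_char_2[OF assms(1), where f = f, folded assms(3)]
  have "locally_nilpotent D \<longleftrightarrow> pderiv f = 0"
  proof
    assume "locally_nilpotent D"
    then obtain m where "m \<ge> 1" "(D ^^ m) (monom 1 1) = 0"
      unfolding locally_nilpotent_def by blast
    then obtain k where "(D ^^ Suc k) (monom 1 1) = 0"
      by (cases m) auto
    then have "pderiv f ^ k * f = 0"
      unfolding iterates by (simp add: assms(3) f_partial_def pderiv_monom)
    moreover have "f \<noteq> 0"
      using assms(3,4) by (auto simp: f_partial_def)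
    ultimately show "pderiv f = 0"
      by simp
  next
    assume "pderiv f = 0"
    then have "(D ^^ 2) p = 0" for p
      using iterates[of 1 p] by (simp add: numeral_2_eq_2)
    moreover have "module_hom smult smult D"
      using assms(2) by (simp add: R_derivation_def)
    ultimately show "locally_nilpotent D"
      unfolding locally_nilpotent_def by (metis one_le_numeral)
  qed
  then show ?thesis
    using pderiv_eq_0_iff_pcompose_CHAR[of f] assms(1) by simp
qed

end
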